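(* Let $\phi:\mathbb{R}^m\to\mathbb{R}^m_{++}$ be a mapping, let $A\in\mathbb{R}^{m\times n}$ with $2\le m<n$ have nonzero columns, let $b\in\mathbb{R}^m$, and let $\Phi_b=\mathrm{diag}(\phi(b))$. If the system $Ax=b$ has a solution $x$ satisfying $\|x\|_0<\left(1+\frac{1}{\mu(\Phi_bA)}\right)/2$, then $x$ is the unique sparsest solution to the linear system.
   Context: $\mathbb{R}^m_{++}$ is the set of vectors in $\mathbb{R}^m$ with all components positive; $\mathrm{diag}(u)$ is the diagonal matrix with diagonal $u$. For a matrix $M\in\mathbb{R}^{m\times n}$ with nonzero columns $c_1,\dots,c_n$, the mutual coherence is $\mu(M)=\max_{i\ne j}\frac{|c_i^Tc_j|}{\|c_i\|_2\|c_j\|_2}$. $\|x\|_0$ is the number of nonzero components of $x$. A solution $x$ of $Ax=b$ is the unique sparsest solution if $\|x\|_0<\|y\|_0$ for every solution $y\ne x$ of $Ay=b$. *)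

theory Defs
  imports "HOL-Analysis.Analysis"
begin

definition positive_orthant :: "(real ^ 'm) set" where
  "positive_orthant = {v. \<forall>i. 0 < v $ i}"

definition diag_mat :: "real ^ 'm \<Rightarrow> real ^ 'm ^ 'm" where
  "diag_mat u = (\<chi> i j. if i = j then u $ i else 0)"

definition l0_norm :: "real ^ 'n \<Rightarrow> nat" where
  "l0_norm x = card {i. x $ i \<noteq> 0}"

(* Meaningful only for a matrix with at least two columns, all of them nonzero:
   otherwise Max is taken over the empty set or a quotient has denominator 0. *)
definition mutual_coherence :: "real ^ 'n ^ 'm \<Rightarrow> real" where
  "mutual_coherence M =
     Max {\<bar>column i M \<bullet> column j M\<bar> / (norm (column i M) * norm (column j M)) | i j. i \<noteq> j}"

definition unique_sparsest_solution :: "real ^ 'n ^ 'm \<Rightarrow> real ^ 'm \<Rightarrow> real ^ 'n \<Rightarrow> bool" where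
  "unique_sparsest_solution A b x \<longleftrightarrow>
     A *v x = b \<and> (\<forall>y. A *v y = b \<and> y \<noteq> x \<longrightarrow> l0_norm x < l0_norm y)"

end

theory Submission
  imports Defs
begin

text \<open>
  A nonzero vector in the kernel of a matrix with nonzero columns must have a large support,
  because its largest column contribution has to be cancelled by the remaining ones, each of
  which projects onto it with a factor of at most the mutual coherence \<open>\<mu>\<close>. Quantitatively, the
  support has at least \<open>1 + 1 / \<mu>\<close> elements (\<open>coherence_kernel_bound\<close>). The difference of two
  distinct solutions \<open>x\<close> and \<open>y\<close> is such a vector, and its support is contained in the union
  of theirs; so the two support sizes add up to at least \<open>1 + 1 / \<mu>\<close>, and if \<open>x\<close> takes less
  than half of this, \<open>y\<close> has to take more than half
  (\<open>sparse_solution_unique_if_coherence\<close>).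

  Scaling the rows by positive weights multiplies the system by an invertible diagonal matrix.
  It leaves the solution set unchanged and keeps the columns nonzero, but it changes the
  coherence, so the criterion may be applied to whichever scaled system is convenient; the
  scaling may even depend on the right-hand side, as that is fixed throughout.
\<close>

lemma l0_norm_diff_le: "l0_norm (x - y) \<le> l0_norm x + l0_norm y"
proof -
  have "{i. (x - y) $ i \<noteq> 0} \<subseteq> {i. x $ i \<noteq> 0} \<union> {i. y $ i \<noteq> 0}"
    by auto
  then have "card {i. (x - y) $ i \<noteq> 0} \<le> card ({i. x $ i \<noteq> 0} \<union> {i. y $ i \<noteq> 0})"
    by (intro card_mono) auto
  also have "\<dots> \<le> l0_norm x + l0_norm y"
    unfolding l0_norm_def by (rule card_Un_le)
  finally show ?thesis
    unfolding l0_norm_def .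
qed

lemma inner_columns_le_mutual_coherence:
  fixes M :: "real ^ 'n ^ 'm"
  assumes "\<And>k. column k M \<noteq> 0" "i \<noteq> j"
  shows "\<bar>column i M \<bullet> column j M\<bar> \<le> mutual_coherence M * (norm (column i M) * norm (column j M))"
proof -
  let ?q = "\<lambda>i j. \<bar>column i M \<bullet> column j M\<bar> / (norm (column i M) * norm (column j M))"
  have "finite {?q i j | i j. i \<noteq> j}"
    by (rule finite_subset[of _ "range (\<lambda>(i, j). ?q i j)"]) auto
  then have "?q i j \<le> mutual_coherence M"
    unfolding mutual_coherence_def using \<open>i \<noteq> j\<close> by (intro Max_ge) auto
  then show ?thesis
    using assms(1) by (simp add: pos_divide_le_eq)
qed

text \<open>
  Weighting each coordinate of \<open>z\<close> by the norm of its column amounts to normalising the columns.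
  If the \<open>i\<close>-th weighted coordinate is largest in modulus, then taking the inner product of
  \<open>M *v z = 0\<close> with column \<open>i\<close> expresses it through the other coordinates in the support of \<open>z\<close>,
  each contributing at most \<open>\<mu>\<close> times that maximum. The bound is left multiplied out
  because it then also yields \<open>\<mu> > 0\<close>, which has to be known before dividing by \<open>\<mu>\<close>.
\<close>
lemma coherence_kernel_bound:
  fixes M :: "real ^ 'n ^ 'm"
  assumes nz: "\<And>j. column j M \<noteq> 0" and ker: "M *v z = 0" and "z \<noteq> 0"
  shows "1 \<le> mutual_coherence M * (real (l0_norm z) - 1)"
proof -
  let ?c = "\<lambda>j. column j M" and ?\<mu> = "mutual_coherence M"
  let ?w = "\<lambda>j. \<bar>z $ j\<bar> * norm (?c j)"
  define S where "S = {j. z $ j \<noteq> 0}"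
  obtain i where i: "\<And>j. ?w j \<le> ?w i"
  proof -
    have "Max (range ?w) \<in> range ?w"
      by (intro Max_in) auto
    then obtain i where "Max (range ?w) = ?w i"
      unfolding image_iff by blast
    moreover have "?w j \<le> Max (range ?w)" for j
      by (rule Max_ge) auto
    ultimately have "?w j \<le> ?w i" for j
      by simp
    then show ?thesis
      by (rule that)
  qed
  obtain k where "z $ k \<noteq> 0"
    using \<open>z \<noteq> 0\<close> by (auto simp: vec_eq_iff)
  then have "0 < ?w k"
    using nz by simp
  then have w_pos: "0 < ?w i"
    using i[of k] by linarith
  then have "i \<in> S"
    by (auto simp: S_def)
  have "0 = (M *v z) \<bullet> ?c i"
    using ker by simp
  also have "\<dots> = (\<Sum>j\<in>UNIV. z $ j * (?c j \<bullet> ?c i))"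
    by (simp add: matrix_mult_sum inner_sum_left scalar_mult_eq_scaleR)
  also have "\<dots> = (\<Sum>j\<in>S. z $ j * (?c j \<bullet> ?c i))"
    by (rule sum.mono_neutral_right) (auto simp: S_def)
  also have "\<dots> = z $ i * (?c i \<bullet> ?c i) + (\<Sum>j\<in>S - {i}. z $ j * (?c j \<bullet> ?c i))"
    using \<open>i \<in> S\<close> by (intro sum.remove) auto
  finally have "\<bar>z $ i * (?c i \<bullet> ?c i)\<bar> = \<bar>\<Sum>j\<in>S - {i}. z $ j * (?c j \<bullet> ?c i)\<bar>"
    by linarith
  then have "?w i * norm (?c i) = \<bar>\<Sum>j\<in>S - {i}. z $ j * (?c j \<bullet> ?c i)\<bar>"
    by (simp add: abs_mult dot_square_norm power2_eq_square)
  also have "\<dots> \<le> (\<Sum>j\<in>S - {i}. \<bar>z $ j * (?c j \<bullet> ?c i)\<bar>)"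
    by (rule sum_abs)
  also have "\<dots> \<le> (\<Sum>j\<in>S - {i}. ?\<mu> * ?w i * norm (?c i))"
  proof (rule sum_mono)
    fix j assume "j \<in> S - {i}"
    then have le: "\<bar>?c j \<bullet> ?c i\<bar> \<le> ?\<mu> * (norm (?c j) * norm (?c i))"
      using inner_columns_le_mutual_coherence[OF nz, of j i] by simp
    then have "0 \<le> ?\<mu> * (norm (?c j) * norm (?c i))"
      using abs_ge_zero order_trans by blast
    moreover have "0 < norm (?c j) * norm (?c i)"
      using nz by simp
    ultimately have "0 \<le> ?\<mu>"
      by (simp only: zero_le_mult_iff) linarith
    have "\<bar>z $ j * (?c j \<bullet> ?c i)\<bar> \<le> \<bar>z $ j\<bar> * (?\<mu> * (norm (?c j) * norm (?c i)))"
      unfolding abs_mult using le by (intro mult_left_mono) auto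
    also have "\<dots> = (?\<mu> * norm (?c i)) * ?w j"
      by (simp add: mult_ac)
    also have "\<dots> \<le> (?\<mu> * norm (?c i)) * ?w i"
      using i \<open>0 \<le> ?\<mu>\<close> by (intro mult_left_mono) auto
    finally show "\<bar>z $ j * (?c j \<bullet> ?c i)\<bar> \<le> ?\<mu> * ?w i * norm (?c i)"
      by (simp add: mult_ac)
  qed
  also have "\<dots> = real (card (S - {i})) * (?\<mu> * ?w i * norm (?c i))"
    by simp
  also have "real (card (S - {i})) = real (card S) - 1"
  proof -
    have "card S = Suc (card (S - {i}))"
      using \<open>i \<in> S\<close> by (intro card.remove) auto
    then show ?thesis
      by simp
  qed
  finally have "1 * (?w i * norm (?c i)) \<le> (?\<mu> * (real (card S) - 1)) * (?w i * norm (?c i))"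
    by (simp add: mult_ac)
  moreover have "0 < ?w i * norm (?c i)"
    using w_pos nz by simp
  ultimately have "1 \<le> ?\<mu> * (real (card S) - 1)"
    using mult_le_cancel_right_pos by blast
  then show ?thesis
    by (simp add: S_def l0_norm_def)
qed

text \<open>
  The classical coherence criterion: two distinct solutions cannot both be sparse, since
  their difference lies in the kernel.
\<close>
theorem sparse_solution_unique_if_coherence:
  fixes M :: "real ^ 'n ^ 'm"
  assumes nz: "\<And>j. column j M \<noteq> 0" and x: "M *v x = b"
    and sparse: "real (l0_norm x) < (1 + 1 / mutual_coherence M) / 2"
  shows "unique_sparsest_solution M b x"
  unfolding unique_sparsest_solution_def
proof (intro conjI allI impI x)
  fix y assume y: "M *v y = b \<and> y \<noteq> x"
  let ?\<mu> = "mutual_coherence M" and ?s = "real (l0_norm (x - y))"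
  have bound: "1 \<le> ?\<mu> * (?s - 1)"
    using y x by (intro coherence_kernel_bound nz) (auto simp: matrix_vector_mult_diff_distrib)
  have "x - y \<noteq> 0"
    using y by auto
  then have "0 < card {i. (x - y) $ i \<noteq> 0}"
    by (simp add: card_gt_0_iff vec_eq_iff)
  then have "0 \<le> ?s - 1"
    by (simp add: l0_norm_def)
  then have "0 < ?\<mu>"
    using bound by (meson less_le_trans linorder_not_less mult_nonpos_nonneg zero_less_one)
  then have "1 + 1 / ?\<mu> \<le> ?s"
    using bound by (simp add: field_simps)
  also have "\<dots> \<le> real (l0_norm x) + real (l0_norm y)"
    using l0_norm_diff_le[of x y] by linarith
  finally have "1 + 1 / ?\<mu> \<le> real (l0_norm x) + real (l0_norm y)" .
  moreover have "2 * real (l0_norm x) < 1 + 1 / ?\<mu>"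
    using sparse by (simp only: less_divide_eq_numeral1 mult.commute)
  ultimately have "real (l0_norm x) < real (l0_norm y)"
    by linarith
  then show "l0_norm x < l0_norm y"
    by simp
qed

lemma diag_mat_mult_vec_nth: "(diag_mat u *v v) $ i = u $ i * v $ i"
  by (simp add: diag_mat_def matrix_vector_mult_def if_distribR if_distrib[of "\<lambda>a. a * _"] cong: if_cong)

lemma inj_diag_mat_mult_vec:
  assumes "u \<in> positive_orthant"
  shows "diag_mat u *v v = diag_mat u *v w \<longleftrightarrow> v = w"
proof -
  have "u $ i \<noteq> 0" for i
    using assms by (simp add: positive_orthant_def less_imp_neq[symmetric])
  then show ?thesis
    by (simp add: vec_eq_iff diag_mat_mult_vec_nth)
qed

text \<open>
  Since the sparsity of a solution does not involve the equations, being the sparsest one is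
  a property of the solution set, which row scaling preserves.
\<close>
lemma unique_sparsest_solution_diag_scaling:
  assumes "u \<in> positive_orthant"
  shows "unique_sparsest_solution (diag_mat u ** A) (diag_mat u *v b) x
    \<longleftrightarrow> unique_sparsest_solution A b x"
  by (simp add: unique_sparsest_solution_def inj_diag_mat_mult_vec[OF assms]
      flip: matrix_vector_mul_assoc)

theorem corollary4p6:
  fixes \<phi> :: "real ^ 'm \<Rightarrow> real ^ 'm"
    and A :: "real ^ 'n ^ 'm"
    and b :: "real ^ 'm"
    and x :: "real ^ 'n"
  assumes "\<And>v. \<phi> v \<in> positive_orthant"
    and "2 \<le> CARD('m)" and "CARD('m) < CARD('n)"
    and "\<And>j. column j A \<noteq> 0"
    and "A *v x = b"
    and "real (l0_norm x) < (1 + 1 / mutual_coherence (diag_mat (\<phi> b) ** A)) / 2"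
  shows "unique_sparsest_solution A b x"
proof -
  let ?D = "diag_mat (\<phi> b)"
  have "column j (?D ** A) \<noteq> 0" for j
  proof -
    have "column j (?D ** A) = ?D *v column j A"
      by (simp flip: matrix_vector_mult_basis matrix_vector_mul_assoc)
    also have "\<dots> \<noteq> ?D *v 0"
      using assms(4) inj_diag_mat_mult_vec[OF assms(1)] by blast
    finally show ?thesis
      by simp
  qed
  moreover have "(?D ** A) *v x = ?D *v b"
    using assms(5) by (simp flip: matrix_vector_mul_assoc)
  ultimately have "unique_sparsest_solution (?D ** A) (?D *v b) x"
    using assms(6) by (rule sparse_solution_unique_if_coherence)
  then show ?thesis
    using unique_sparsest_solution_diag_scaling[OF assms(1)] by blast
qed

end
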